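(* For each $x\in(-\frac{\sqrt3}{2},\frac{\sqrt3}{2})$ there exists a representation $\rho_x:G(3_1)\to\mathcal E(E^3)$, unique up to conjugation in $\mathcal E(E^3)$, such that $$\rho_x(a)=(sA^-,A),\qquad \rho_x(b)=(sB^-+(A^-B^-)^-,B),$$ where $$A=x+\frac{2x^2-1}{2\sqrt{1-x^2}}\,i+\frac12\sqrt{\frac{3-4x^2}{1-x^2}}\,j,\qquad B=x+\sqrt{1-x^2}\,i,\quad \sqrt{1-x^2}>0 .$$ In affine linear notation, where $(X,Y,Z)$ is the coordinate system associated to the basis $\{-ij,j,i\}$ of $H_0$ and a transformation acts on the column vector $(X,Y,Z,1)^T$, $\rho_x(a)$ and $\rho_x(b)$ are given by the matrices $$M_x(a)=\begin{pmatrix} 2x^2-1&\frac{x-2x^3}{\sqrt{1-x^2}}&x\sqrt{\frac{4x^2-3}{x^2-1}}&0\\ \frac{x(2x^2-1)}{\sqrt{1-x^2}}&\frac{-4x^4+2x^2+1}{2-2x^2}&\frac{(1-2x^2)\sqrt{3-4x^2}}{2(x^2-1)}&\frac{\sqrt{(3-4x^2)^3}}{8x\sqrt{1-x^2}}\\ -x\sqrt{\frac{4x^2-3}{x^2-1}}&\frac{(1-2x^2)\sqrt{3-4x^2}}{2(x^2-1)}&\frac{1-2x^2}{2x^2-2}&\frac{-8x^4+10x^2-3}{8x\sqrt{1-x^2}}\\ 0&0&0&1\end{pmatrix},$$ $$M_x(b)=\begin{pmatrix} 2x^2-1&-2x\sqrt{1-x^2}&0&-\frac12\sqrt{3-4x^2}\\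 2x\sqrt{1-x^2}&2x^2-1&0&0\\ 0&0&1&\frac{(3-4x^2)\sqrt{1-x^2}}{4x}\\ 0&0&0&1\end{pmatrix}.$$ The distance $\delta$ and the angle $\omega$ between the axes of $\rho_x(a)$ and $\rho_x(b)$ are given by $$\delta=\frac{\sqrt{3-4x^2}}{4},\qquad \cos\omega=\frac{2x^2-1}{2-2x^2},$$ and the shift $\sigma$ is $$\sigma=\left(\frac{3}{4x}-x\right)\sqrt{1-x^2}.$$
   Context: $G(3_1)=\langle a,b\mid aba=bab\rangle$ is the trefoil knot group. $\mathbb H$ is the algebra of Hamilton quaternions with basis $1,i,j,ij$, $i^2=j^2=-1$, $ij=-ji$. For a quaternion $A$ write $A=A^++A^-$ with $A^+$ the scalar part and $A^-$ the pure part; $\overline A=A^+-A^-$. $H_0$ is the space of pure quaternions, identified with Euclidean space $E^3$ via the norm $N(v)=v\overline v$, and $S^3$ is the group of unit quaternions. $\mathcal E(E^3)$ is the group of direct affine isometries of $E^3$; the element $(v,A)\in H_0\rtimes S^3$ denotes the isometry $u\mapsto v+Au\overline{A}$. The number $s\in\mathbb R$ is the vector shift parameter: if $v=sA^-+v^{\perp}$ with $v^\perp$ orthogonal to $A^-$, then $(v,A)$ leaves invariant a line parallel to $A^-$, called its axis, and acts on it as translation by $sA^-$. The shift of $(v,A)$ is $\sigma=s\sqrt{N(A^-)}$. The angle $\omega$ between the axes is the angle between the vectors $A^-$ and $B^-$.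
   Formalization: x=0 is excluded, since there the relation aba=bab would need 4xs=3-4x^2, which has no solution s; the (1,4) entry of M_x(b) is +½√(3-4x²) instead of the printed -½√(3-4x²), which contradicts (A^-B^-)^- in the basis {-ij,j,i}. *)

theory Defs
  imports "HOL-Analysis.Analysis" "HOL-Algebra.Group"
begin

section \<open>Groups given by generators and relations\<close>

text \<open>A letter is a generator (\<^const>\<open>True\<close>) or its formal inverse (\<^const>\<open>False\<close>).\<close>

type_synonym 'g word = "('g \<times> bool) list"

inductive word_equiv :: "('g word \<times> 'g word) set \<Rightarrow> 'g word \<Rightarrow> 'g word \<Rightarrow> bool"
  for R :: "('g word \<times> 'g word) set"
where
  relator: "(u, v) \<in> R \<Longrightarrow> word_equiv R (p @ u @ q) (p @ v @ q)"
| cancel: "word_equiv R (p @ [(g, e), (g, \<not> e)] @ q) (p @ q)"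
| refl: "word_equiv R u u"
| sym: "word_equiv R u v \<Longrightarrow> word_equiv R v u"
| trans: "word_equiv R u v \<Longrightarrow> word_equiv R v w \<Longrightarrow> word_equiv R u w"

definition word_class :: "('g word \<times> 'g word) set \<Rightarrow> 'g word \<Rightarrow> 'g word set"
  where "word_class R u = {v. word_equiv R u v}"

definition presented_group :: "('g word \<times> 'g word) set \<Rightarrow> 'g word set monoid"
  where "presented_group R =
    \<lparr>carrier = range (word_class R),
     mult = (\<lambda>U V. \<Union>u\<in>U. \<Union>v\<in>V. word_class R (u @ v)),
     one = word_class R []\<rparr>"

lemma word_equiv_append_left: "word_equiv R u v \<Longrightarrow> word_equiv R (w @ u) (w @ v)"
proof (induction rule: word_equiv.induct)
  case (relator u v p q)
  then show ?case using word_equiv.relator[of u v R "w @ p" q] by simp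
next
  case (cancel p g e q)
  then show ?case using word_equiv.cancel[of R "w @ p" g e q] by simp
qed (blast intro: word_equiv.intros)+

lemma word_equiv_append_right: "word_equiv R u v \<Longrightarrow> word_equiv R (u @ w) (v @ w)"
proof (induction rule: word_equiv.induct)
  case (relator u v p q)
  then show ?case using word_equiv.relator[of u v R p "q @ w"] by simp
next
  case (cancel p g e q)
  then show ?case using word_equiv.cancel[of R p g e "q @ w"] by simp
qed (blast intro: word_equiv.intros)+

lemma word_equiv_append:
  "word_equiv R u u' \<Longrightarrow> word_equiv R v v' \<Longrightarrow> word_equiv R (u @ v) (u' @ v')"
  by (meson word_equiv.trans word_equiv_append_left word_equiv_append_right)

lemma word_class_eq_iff: "word_class R u = word_class R v \<longleftrightarrow> word_equiv R u v"
  unfolding word_class_def by (blast intro: word_equiv.intros)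

lemma presented_group_mult:
  "word_class R u \<otimes>\<^bsub>presented_group R\<^esub> word_class R v = word_class R (u @ v)"
proof -
  let ?U = "word_class R u" and ?V = "word_class R v"
  have "u \<in> ?U" "v \<in> ?V"
    by (simp_all add: word_class_def word_equiv.refl)
  have "word_class R (u' @ v') = word_class R (u @ v)" if "u' \<in> ?U" "v' \<in> ?V" for u' v'
    using that unfolding word_class_eq_iff
    by (auto simp: word_class_def intro: word_equiv.sym word_equiv_append)
  then have "(\<Union>u'\<in>?U. \<Union>v'\<in>?V. word_class R (u' @ v'))
      = (\<Union>u'\<in>?U. \<Union>v'\<in>?V. word_class R (u @ v))"
    by (intro SUP_cong HOL.refl)
  also have "\<dots> = word_class R (u @ v)"
    using \<open>u \<in> ?U\<close> \<open>v \<in> ?V\<close> by blast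
  finally show ?thesis by (simp add: presented_group_def)
qed

lemma word_equiv_left_inverse:
  "word_equiv R (rev (map (\<lambda>(g, e). (g, \<not> e)) u) @ u) []"
proof (induction u)
  case Nil
  then show ?case by (simp add: word_equiv.refl)
next
  case (Cons l u)
  obtain g e where l: "l = (g, e)" by (cases l)
  let ?v = "rev (map (\<lambda>(g, e). (g, \<not> e)) u)"
  have "word_equiv R (?v @ [(g, \<not> e), (g, \<not> \<not> e)] @ u) (?v @ u)"
    by (rule word_equiv.cancel)
  then have "word_equiv R (?v @ [(g, \<not> e), (g, e)] @ u) []"
    using Cons.IH by (auto intro: word_equiv.trans)
  then show ?case by (simp add: l)
qed

lemma group_presented_group: "group (presented_group R)"
proof -
  have carrier: "carrier (presented_group R) = range (word_class R)"
    and one: "\<one>\<^bsub>presented_group R\<^esub> = word_class R []"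
    by (simp_all add: presented_group_def)
  show ?thesis
  proof (rule groupI)
    show "\<exists>y\<in>carrier (presented_group R). y \<otimes>\<^bsub>presented_group R\<^esub> x = \<one>\<^bsub>presented_group R\<^esub>"
      if x_in: "x \<in> carrier (presented_group R)" for x
    proof -
      obtain u where x: "x = word_class R u" using x_in by (auto simp: carrier)
      let ?v = "rev (map (\<lambda>(g, e). (g, \<not> e)) u)"
      have "word_class R ?v \<otimes>\<^bsub>presented_group R\<^esub> x = \<one>\<^bsub>presented_group R\<^esub>"
        unfolding x presented_group_mult one
        by (simp add: word_class_eq_iff word_equiv_left_inverse)
      then show ?thesis unfolding carrier by blast
    qed
  next
    show "x \<otimes>\<^bsub>presented_group R\<^esub> y \<in> carrier (presented_group R)"
      if "x \<in> carrier (presented_group R)" "y \<in> carrier (presented_group R)" for x y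
      using that unfolding carrier by (auto simp: presented_group_mult)
    show "x \<otimes>\<^bsub>presented_group R\<^esub> y \<otimes>\<^bsub>presented_group R\<^esub> z
        = x \<otimes>\<^bsub>presented_group R\<^esub> (y \<otimes>\<^bsub>presented_group R\<^esub> z)"
      if "x \<in> carrier (presented_group R)" "y \<in> carrier (presented_group R)"
        "z \<in> carrier (presented_group R)" for x y z
      using that unfolding carrier by (auto simp: presented_group_mult)
    show "\<one>\<^bsub>presented_group R\<^esub> \<in> carrier (presented_group R)"
      unfolding carrier one by simp
    show "\<one>\<^bsub>presented_group R\<^esub> \<otimes>\<^bsub>presented_group R\<^esub> x = x"
      if "x \<in> carrier (presented_group R)" for x
      using that unfolding carrier one by (auto simp: presented_group_mult)
  qed
qed

datatype trefoil_gen = Gen_a | Gen_b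

definition trefoil_group :: "trefoil_gen word set monoid"
  where "trefoil_group = presented_group
    {([(Gen_a, True), (Gen_b, True), (Gen_a, True)],
      [(Gen_b, True), (Gen_a, True), (Gen_b, True)])}"

definition trefoil_elt :: "trefoil_gen \<Rightarrow> trefoil_gen word set"
  where "trefoil_elt g = word_class
    {([(Gen_a, True), (Gen_b, True), (Gen_a, True)],
      [(Gen_b, True), (Gen_a, True), (Gen_b, True)])} [(g, True)]"

lemma trefoil_relation:
  "trefoil_elt Gen_a \<otimes>\<^bsub>trefoil_group\<^esub> trefoil_elt Gen_b \<otimes>\<^bsub>trefoil_group\<^esub> trefoil_elt Gen_a
   = trefoil_elt Gen_b \<otimes>\<^bsub>trefoil_group\<^esub> trefoil_elt Gen_a \<otimes>\<^bsub>trefoil_group\<^esub> trefoil_elt Gen_b"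
  unfolding trefoil_group_def trefoil_elt_def presented_group_mult word_class_eq_iff
  using word_equiv.relator[OF singletonI, of _ _ "[]" "[]"] by simp

section \<open>Hamilton quaternions\<close>

datatype quat = Quat (q_re: real) (q_i: real) (q_j: real) (q_ij: real)

lemma quat_eq_iff:
  "p = q \<longleftrightarrow> q_re p = q_re q \<and> q_i p = q_i q \<and> q_j p = q_j q \<and> q_ij p = q_ij q"
  by (cases p; cases q) simp

instantiation quat :: real_algebra_1
begin

definition "0 = Quat 0 0 0 0"
definition "1 = Quat 1 0 0 0"
definition "p + q = Quat (q_re p + q_re q) (q_i p + q_i q) (q_j p + q_j q) (q_ij p + q_ij q)"
definition "- p = Quat (- q_re p) (- q_i p) (- q_j p) (- q_ij p)"
definition "p - q = Quat (q_re p - q_re q) (q_i p - q_i q) (q_j p - q_j q) (q_ij p - q_ij q)"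
definition "r *\<^sub>R p = Quat (r * q_re p) (r * q_i p) (r * q_j p) (r * q_ij p)"
definition "p * q = Quat
  (q_re p * q_re q - q_i p * q_i q - q_j p * q_j q - q_ij p * q_ij q)
  (q_re p * q_i q + q_i p * q_re q + q_j p * q_ij q - q_ij p * q_j q)
  (q_re p * q_j q - q_i p * q_ij q + q_j p * q_re q + q_ij p * q_i q)
  (q_re p * q_ij q + q_i p * q_j q - q_j p * q_i q + q_ij p * q_re q)"

instance
  by standard
    (auto simp: zero_quat_def one_quat_def plus_quat_def uminus_quat_def minus_quat_def
      scaleR_quat_def times_quat_def algebra_simps)

end

definition qI :: quat where "qI = Quat 0 1 0 0"
definition qJ :: quat where "qJ = Quat 0 0 1 0"

lemma quat_basis_relations: "qI * qI = -1" "qJ * qJ = -1" "qI * qJ = - (qJ * qI)"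
  by (simp_all add: qI_def qJ_def quat_eq_iff times_quat_def one_quat_def uminus_quat_def)

lemma quat_basis_expansion:
  "Quat t u v w = of_real t + u *\<^sub>R qI + v *\<^sub>R qJ + w *\<^sub>R (qI * qJ)"
  by (simp add: of_real_def qI_def qJ_def times_quat_def scaleR_quat_def plus_quat_def one_quat_def)

definition pure_part :: "quat \<Rightarrow> quat"
  where "pure_part q = q - of_real (q_re q)"

definition q_cnj :: "quat \<Rightarrow> quat"
  where "q_cnj q = of_real (q_re q) - pure_part q"

definition q_norm :: "quat \<Rightarrow> real"
  where "q_norm q = q_re (q * q_cnj q)"

lemma q_norm_eq: "q * q_cnj q = of_real (q_norm q)"
  by (simp add: q_norm_def q_cnj_def pure_part_def of_real_def quat_eq_iff times_quat_def
      minus_quat_def scaleR_quat_def one_quat_def algebra_simps)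

definition pure_quats :: "quat set"
  where "pure_quats = {q. q_re q = 0}"

definition unit_quats :: "quat set"
  where "unit_quats = {q. q_norm q = 1}"

section \<open>Direct affine isometries of Euclidean space\<close>

text \<open>Pure quaternions are identified with Euclidean 3-space by means of the coordinates
  with respect to the orthonormal basis \<open>{-ij, j, i}\<close>.\<close>

definition pure_of :: "real^3 \<Rightarrow> quat"
  where "pure_of p = p $ 1 *\<^sub>R (- (qI * qJ)) + p $ 2 *\<^sub>R qJ + p $ 3 *\<^sub>R qI"

definition coords :: "quat \<Rightarrow> real^3"
  where "coords q = vector [- q_ij q, q_j q, q_i q]"

lemma coords_pure_of: "coords (pure_of p) = p"
  by (simp add: coords_def pure_of_def vec_eq_iff forall_3 qI_def qJ_def
      times_quat_def plus_quat_def scaleR_quat_def uminus_quat_def)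

lemma pure_of_coords: "q \<in> pure_quats \<Longrightarrow> pure_of (coords q) = q"
  by (simp add: coords_def pure_of_def pure_quats_def quat_eq_iff qI_def qJ_def
      times_quat_def plus_quat_def scaleR_quat_def uminus_quat_def)

lemma pure_of_pure: "pure_of p \<in> pure_quats"
  by (simp add: pure_of_def pure_quats_def qI_def qJ_def
      times_quat_def plus_quat_def scaleR_quat_def uminus_quat_def)

lemma q_norm_pure_of: "q_norm (pure_of p) = (norm p)\<^sup>2"
  by (simp add: power2_norm_eq_inner inner_vec_def sum_3 q_norm_def q_cnj_def pure_part_def
      pure_of_def qI_def qJ_def of_real_def times_quat_def plus_quat_def minus_quat_def
      scaleR_quat_def uminus_quat_def one_quat_def)

definition direct_isometry :: "(real^3 \<Rightarrow> real^3) \<Rightarrow> bool"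
  where "direct_isometry f \<longleftrightarrow> (\<exists>R t. rotation_matrix R \<and> f = (\<lambda>p. t + R *v p))"

definition isom_group :: "(real^3 \<Rightarrow> real^3) monoid"
  where "isom_group = \<lparr>carrier = {f. direct_isometry f}, mult = (\<circ>), one = id\<rparr>"

lemma group_isom_group: "group isom_group"
proof (rule groupI)
  fix f g
  assume "f \<in> carrier isom_group" "g \<in> carrier isom_group"
  then obtain R s S t where f: "rotation_matrix R" "f = (\<lambda>p. s + R *v p)"
    and g: "rotation_matrix S" "g = (\<lambda>p. t + S *v p)"
    by (auto simp: isom_group_def direct_isometry_def)
  have "rotation_matrix (R ** S)"
    using f(1) g(1) by (simp add: rotation_matrix_def orthogonal_matrix_mul det_mul)
  moreover have "f \<circ> g = (\<lambda>p. (s + R *v t) + (R ** S) *v p)"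
    by (simp add: f g fun_eq_iff matrix_vector_right_distrib matrix_vector_mul_assoc add.assoc)
  ultimately show "f \<otimes>\<^bsub>isom_group\<^esub> g \<in> carrier isom_group"
    by (auto simp: isom_group_def direct_isometry_def)
next
  have "rotation_matrix (mat 1 :: real^3^3)" "id = (\<lambda>p. 0 + (mat 1 :: real^3^3) *v p)"
    by (auto simp: rotation_matrix_def orthogonal_matrix_id)
  then show "\<one>\<^bsub>isom_group\<^esub> \<in> carrier isom_group"
    unfolding isom_group_def direct_isometry_def by force
next
  fix f
  assume "f \<in> carrier isom_group"
  then obtain R s where f: "rotation_matrix R" "f = (\<lambda>p. s + R *v p)"
    by (auto simp: isom_group_def direct_isometry_def)
  let ?T = "transpose R"
  let ?g = "\<lambda>p. - (?T *v s) + ?T *v p"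
  have "rotation_matrix ?T"
    using f(1) by (simp add: rotation_matrix_def orthogonal_matrix_transpose)
  then have "?g \<in> carrier isom_group"
    unfolding isom_group_def direct_isometry_def by fastforce
  moreover have "?T *v (R *v p) = p" for p
    using f(1) by (metis matrix_vector_mul_assoc matrix_vector_mul_lid
        orthogonal_matrix rotation_matrix_def)
  then have "?g \<circ> f = id"
    by (simp add: f(2) fun_eq_iff matrix_vector_right_distrib del: transpose_matrix_vector)
  ultimately show "\<exists>g\<in>carrier isom_group. g \<otimes>\<^bsub>isom_group\<^esub> f = \<one>\<^bsub>isom_group\<^esub>"
    by (metis (no_types, lifting) isom_group_def monoid.select_convs)
qed (auto simp: isom_group_def o_assoc)

definition isom :: "quat \<times> quat \<Rightarrow> real^3 \<Rightarrow> real^3"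
  where "isom = (\<lambda>(v, A) p. coords (v + A * pure_of p * q_cnj A))"

definition axis_of :: "quat \<times> quat \<Rightarrow> (real^3) set"
  where "axis_of = (\<lambda>(v, A). THE L.
    (\<exists>p. L = range (\<lambda>t. p + t *\<^sub>R coords (pure_part A))) \<and> isom (v, A) ` L = L)"

definition vector_shift :: "quat \<times> quat \<Rightarrow> real"
  where "vector_shift = (\<lambda>(v, A). THE s. \<exists>w\<in>pure_quats.
    v = s *\<^sub>R pure_part A + w \<and> orthogonal (coords w) (coords (pure_part A)))"

definition shift :: "quat \<times> quat \<Rightarrow> real"
  where "shift = (\<lambda>(v, A). vector_shift (v, A) * sqrt (q_norm (pure_part A)))"

definition vec_angle :: "real^3 \<Rightarrow> real^3 \<Rightarrow> real"
  where "vec_angle u v = arccos (inner u v / (norm u * norm v))"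

definition axes_angle :: "quat \<times> quat \<Rightarrow> quat \<times> quat \<Rightarrow> real"
  where "axes_angle = (\<lambda>(v, A) (w, B). vec_angle (coords (pure_part A)) (coords (pure_part B)))"

definition homogeneous :: "real^3 \<Rightarrow> real^4"
  where "homogeneous p = vector [p $ 1, p $ 2, p $ 3, 1]"

definition conjugate_reps :: "('g, 'm) monoid_scheme \<Rightarrow> ('e, 'n) monoid_scheme
    \<Rightarrow> ('g \<Rightarrow> 'e) \<Rightarrow> ('g \<Rightarrow> 'e) \<Rightarrow> bool"
  where "conjugate_reps G E \<rho> \<rho>' \<longleftrightarrow>
    (\<exists>c\<in>carrier E. \<forall>g\<in>carrier G. \<rho>' g = c \<otimes>\<^bsub>E\<^esub> \<rho> g \<otimes>\<^bsub>E\<^esub> inv\<^bsub>E\<^esub> c)"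

section \<open>The family of representations\<close>

definition quat_A :: "real \<Rightarrow> quat"
  where "quat_A x = of_real x
    + ((2*x^2 - 1) / (2 * sqrt (1 - x^2))) *\<^sub>R qI
    + (1/2 * sqrt ((3 - 4*x^2) / (1 - x^2))) *\<^sub>R qJ"

definition quat_B :: "real \<Rightarrow> quat"
  where "quat_B x = of_real x + sqrt (1 - x^2) *\<^sub>R qI"

definition elt_a :: "real \<Rightarrow> quat \<Rightarrow> quat \<times> quat"
  where "elt_a s A = (s *\<^sub>R pure_part A, A)"

definition elt_b :: "real \<Rightarrow> quat \<Rightarrow> quat \<Rightarrow> quat \<times> quat"
  where "elt_b s A B = (s *\<^sub>R pure_part B + pure_part (pure_part A * pure_part B), B)"

definition matrix_a :: "real \<Rightarrow> real^4^4"
  where "matrix_a x = vector [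
    vector [2*x^2 - 1,
            (x - 2*x^3) / sqrt (1 - x^2),
            x * sqrt ((4*x^2 - 3) / (x^2 - 1)),
            0],
    vector [x * (2*x^2 - 1) / sqrt (1 - x^2),
            (- 4*x^4 + 2*x^2 + 1) / (2 - 2*x^2),
            (1 - 2*x^2) * sqrt (3 - 4*x^2) / (2 * (x^2 - 1)),
            sqrt ((3 - 4*x^2)^3) / (8*x * sqrt (1 - x^2))],
    vector [- x * sqrt ((4*x^2 - 3) / (x^2 - 1)),
            (1 - 2*x^2) * sqrt (3 - 4*x^2) / (2 * (x^2 - 1)),
            (1 - 2*x^2) / (2*x^2 - 2),
            (- 8*x^4 + 10*x^2 - 3) / (8*x * sqrt (1 - x^2))],
    vector [0, 0, 0, 1]]"

text \<open>The last entry of the first row is the coordinate of \<open>(A\<^sup>-B\<^sup>-)\<^sup>-\<close> along \<open>-ij\<close>, which is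
  positive. With the opposite sign the two matrices do not satisfy \<open>aba = bab\<close>.\<close>

definition matrix_b :: "real \<Rightarrow> real^4^4"
  where "matrix_b x = vector [
    vector [2*x^2 - 1, - 2*x * sqrt (1 - x^2), 0, 1/2 * sqrt (3 - 4*x^2)],
    vector [2*x * sqrt (1 - x^2), 2*x^2 - 1, 0, 0],
    vector [0, 0, 1, (3 - 4*x^2) * sqrt (1 - x^2) / (4*x)],
    vector [0, 0, 0, 1]]"

end

theory Submission
  imports Defs
begin

text \<open>
  For unit quaternions \<open>A\<close>, \<open>B\<close> with common real part \<open>x\<close>, the Cayley-Hamilton identity gives
  \<open>ABA - BAB = (t - 1)(A - B)\<close> with \<open>t = 2 Re(AB)\<close>, so for non-commuting \<open>A\<close>, \<open>B\<close> the braid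
  relation between the rotations forces \<open>t = 1\<close>, that is, \<open>a \<bullet> b = x\<^sup>2 - 1/2\<close> for the pure parts
  (the sign \<open>ABA = -BAB\<close> is impossible since \<open>x \<noteq> 0\<close>). Given this, the translation parts of the two
  sides differ by \<open>(4xs - (3 - 4x\<^sup>2)) a \<times> b\<close>, which determines the shift parameter \<open>s\<close>.
  Hence the Gram matrix of the pure parts and \<open>s\<close> are functions of \<open>x\<close>, and the rotation carrying
  one pair of pure parts to the other conjugates the representations. The axis of the image of the
  first generator passes through \<open>(x/2) a\<close>, that of the second through \<open>(x/2) a + (1/2) a \<times> b\<close>,
  so \<open>(1/2) a \<times> b\<close> is their common perpendicular.
\<close>

unbundle cross3_syntax

section \<open>Homomorphisms out of a presented group\<close>

fun word_val :: "('m, 'n) monoid_scheme \<Rightarrow> ('g \<Rightarrow> 'm) \<Rightarrow> 'g word \<Rightarrow> 'm" where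
  "word_val H f [] = \<one>\<^bsub>H\<^esub>"
| "word_val H f ((g, e) # u) = (if e then f g else inv\<^bsub>H\<^esub> f g) \<otimes>\<^bsub>H\<^esub> word_val H f u"

context group
begin

lemma word_val_closed: "range f \<subseteq> carrier G \<Longrightarrow> word_val G f u \<in> carrier G"
  by (induction u) (auto simp: image_subset_iff)

lemma word_val_append:
  assumes "range f \<subseteq> carrier G"
  shows "word_val G f (u @ v) = word_val G f u \<otimes> word_val G f v"
proof (induction u)
  case Nil
  then show ?case using assms by (simp add: word_val_closed)
next
  case (Cons l u)
  obtain g e where "l = (g, e)" by (cases l)
  moreover have "f g \<in> carrier G" using assms by auto
  ultimately show ?case using Cons assms by (simp add: word_val_closed m_assoc)
qed

text \<open>Induction over the generation of \<open>word_equiv\<close>: relators are respected by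
  hypothesis, cancellations by the inverse laws of the target group.\<close>

lemma word_val_equiv:
  assumes f: "range f \<subseteq> carrier G"
    and R: "\<And>u v. (u, v) \<in> R \<Longrightarrow> word_val G f u = word_val G f v"
    and "word_equiv R u v"
  shows "word_val G f u = word_val G f v"
  using assms(3)
proof (induction rule: word_equiv.induct)
  case (relator u v p q)
  then show ?case by (simp add: word_val_append[OF f] R)
next
  case (cancel p g e q)
  have g: "f g \<in> carrier G" using f by auto
  have "word_val G f [(g, e), (g, \<not> e)] = \<one>" using g by simp
  then show ?case
    unfolding word_val_append[OF f] by (simp add: word_val_closed[OF f])
qed auto

text \<open>Universal property of the presentation (von Dyck): evaluation of words is constant on
  classes, so it descends to the quotient.\<close>

lemma presented_group_hom_exists:
  assumes f: "range f \<subseteq> carrier G"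
    and R: "\<And>u v. (u, v) \<in> R \<Longrightarrow> word_val G f u = word_val G f v"
  obtains \<rho> where "\<rho> \<in> hom (presented_group R) G" "\<And>g. \<rho> (word_class R [(g, True)]) = f g"
proof -
  \<comment> \<open>An arbitrary representative is chosen; \<open>val\<close> shows that the choice
    does not affect the value.\<close>
  define \<rho> where "\<rho> U = word_val G f (SOME u. U = word_class R u)" for U
  have val: "\<rho> (word_class R u) = word_val G f u" for u
  proof -
    have "word_class R u = word_class R (SOME v. word_class R u = word_class R v)"
      by (rule someI_ex) blast
    then show ?thesis
      unfolding \<rho>_def by (metis word_class_eq_iff word_val_equiv[OF f R])
  qed
  have "\<rho> \<in> hom (presented_group R) G"
  proof (rule homI)
    fix U V assume "U \<in> carrier (presented_group R)" "V \<in> carrier (presented_group R)"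
    then obtain u v where [simp]: "U = word_class R u" "V = word_class R v"
      by (auto simp: presented_group_def)
    show "\<rho> U \<in> carrier G" by (simp add: val word_val_closed[OF f])
    show "\<rho> (U \<otimes>\<^bsub>presented_group R\<^esub> V) = \<rho> U \<otimes> \<rho> V"
      by (simp add: presented_group_mult val word_val_append[OF f])
  qed
  moreover have "\<rho> (word_class R [(g, True)]) = f g" for g
    using f by (simp add: val image_subset_iff)
  ultimately show thesis using that by blast
qed

text \<open>Every class is a product of one-letter classes, and the class of an inverse letter is
  the inverse of a generator.\<close>

lemma presented_group_hom_unique:
  assumes \<rho>: "\<rho> \<in> hom (presented_group R) G" and \<rho>': "\<rho>' \<in> hom (presented_group R) G"
    and gen: "\<And>g. \<rho> (word_class R [(g, True)]) = \<rho>' (word_class R [(g, True)])"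
    and "U \<in> carrier (presented_group R)"
  shows "\<rho> U = \<rho>' U"
proof -
  interpret P: group "presented_group R" by (rule group_presented_group)
  interpret h: group_hom "presented_group R" G \<rho> by unfold_locales (rule \<rho>)
  interpret h': group_hom "presented_group R" G \<rho>' by unfold_locales (rule \<rho>')
  have carrier: "word_class R u \<in> carrier (presented_group R)" for u
    by (simp add: presented_group_def)
  have one: "\<one>\<^bsub>presented_group R\<^esub> = word_class R []" by (simp add: presented_group_def)
  have inv: "word_class R [(g, False)] = inv\<^bsub>presented_group R\<^esub> word_class R [(g, True)]" for g
    \<comment> \<open>With \<open>e = False\<close> the cancelled word is
      \<open>[(g, False), (g, True)]\<close>, which is the left inverse law.\<close>
    using word_equiv.cancel[of R "[]" g False "[]"]
    by (intro P.inv_equality[symmetric]) (simp_all add: carrier presented_group_mult one word_class_eq_iff)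
  have letter: "\<rho> (word_class R [(g, e)]) = \<rho>' (word_class R [(g, e)])" for g e
  proof (cases e)
    case False
    then show ?thesis
      by (simp add: inv gen carrier)
  qed (simp add: gen)
  have "\<rho> (word_class R u) = \<rho>' (word_class R u)" for u
  proof (induction u)
    case Nil
    then show ?case
      using h.hom_one h'.hom_one by (simp add: one)
  next
    case (Cons l u)
    have split: "word_class R (l # u) = word_class R [l] \<otimes>\<^bsub>presented_group R\<^esub> word_class R u"
      by (simp add: presented_group_mult)
    show ?case
      unfolding split using Cons letter[of "fst l" "snd l"] carrier by simp
  qed
  then show ?thesis using assms(4) by (auto simp: presented_group_def)
qed

lemma conjugation_hom:
  assumes "\<rho> \<in> hom H G" and c: "c \<in> carrier G"
  shows "(\<lambda>g. c \<otimes> \<rho> g \<otimes> inv c) \<in> hom H G"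
proof (rule homI)
  fix g h assume gh: "g \<in> carrier H" "h \<in> carrier H"
  then have cl: "\<rho> g \<in> carrier G" "\<rho> h \<in> carrier G" using assms(1) by (auto simp: hom_def)
  show "c \<otimes> \<rho> g \<otimes> inv c \<in> carrier G" using cl c by simp
  have "inv c \<otimes> (c \<otimes> (\<rho> h \<otimes> inv c)) = \<rho> h \<otimes> inv c"
    using cl c by (simp add: m_assoc[symmetric])
  then show "c \<otimes> \<rho> (g \<otimes>\<^bsub>H\<^esub> h) \<otimes> inv c = (c \<otimes> \<rho> g \<otimes> inv c) \<otimes> (c \<otimes> \<rho> h \<otimes> inv c)"
    using cl c gh by (simp add: hom_mult[OF assms(1)] m_assoc)
qed

end

section \<open>Rotations of Euclidean 3-space\<close>

text \<open>The matrices with rows \<open>a\<close>, \<open>b\<close>, \<open>a \<times> b\<close>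
  have the same Gram matrix for both pairs, so they differ by an orthogonal matrix. Their common
  determinant is the squared length of \<open>a \<times> b\<close>, nonzero by independence, so that
  matrix has determinant 1.\<close>

lemma rotation_between_pairs:
  fixes a b a' b' :: "real^3"
  assumes "a \<bullet> a = a' \<bullet> a'" "b \<bullet> b = b' \<bullet> b'" "a \<bullet> b = a' \<bullet> b'" and indep: "a \<times> b \<noteq> 0"
  obtains R where "rotation_matrix R" "R *v a = a'" "R *v b = b'"
proof -
  define V where "V a b = (vector [a, b, a \<times> b] :: real^3^3)" for a b
  have mult_transpose: "(M ** transpose M) $ i $ j = M $ i \<bullet> M $ j" for M :: "real^3^3" and i j
    by (simp add: matrix_matrix_mult_def transpose_def inner_vec_def)
  have gram: "V a b ** transpose (V a b) = V a' b' ** transpose (V a' b')"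
    using assms(1-3) dot_cross[of a b a b] dot_cross[of a' b' a' b']
    by (simp add: vec_eq_iff mult_transpose forall_3 V_def
        dot_cross_self inner_commute)
  have det: "det (V a b) = (a \<times> b) \<bullet> (a \<times> b)" for a b
    by (simp add: V_def flip: dot_cross_det) (metis cross_triple inner_commute)
  have dets: "det (V a b) = det (V a' b')"
    using assms(1-3) unfolding det dot_cross by (simp add: inner_commute)
  have "det (V a b) \<noteq> 0" using indep by (simp add: det)
  then obtain W where W: "V a b ** W = mat 1" "W ** V a b = mat 1"
    by (metis invertible_def invertible_det_nz)
  \<comment> \<open>The vectors are rows, so \<open>R\<close> maps the old triple to the new one
    exactly when \<open>V a b ** transpose R = V a' b'\<close>.\<close>
  define R where "R = transpose (W ** V a' b')"
  have "transpose R ** R = W ** (V a' b' ** transpose (V a' b')) ** transpose W"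
    by (simp add: R_def matrix_transpose_mul matrix_mul_assoc)
  also have "\<dots> = (W ** V a b) ** transpose (W ** V a b)"
    by (simp add: gram[symmetric] matrix_transpose_mul matrix_mul_assoc)
  finally have "orthogonal_matrix R" using W by (simp add: orthogonal_matrix)
  moreover have "det R = 1"
    using arg_cong[OF W(2), of det] by (simp add: R_def det_mul dets del: transpose_matrix_vector)
  moreover have "V a b ** transpose R = V a' b'"
    by (simp add: R_def matrix_mul_assoc W)
  then have "row i (V a b ** transpose R) = row i (V a' b')" for i by simp
  then have "R *v row i (V a b) = row i (V a' b')" for i
    by (simp add: vec_eq_iff row_def matrix_matrix_mult_def matrix_vector_mult_def transpose_def mult.commute)
  from this[of 1] this[of 2] have "R *v a = a'" "R *v b = b'"
    by (simp_all add: V_def row_def)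
  ultimately show thesis using that by (auto simp: rotation_matrix_def)
qed

text \<open>Rodrigues' formula: if \<open>c\<^sup>2 + \<bar>a\<bar>\<^sup>2 = 1\<close>, this is the rotation
  \<open>p \<mapsto> A p A\<^sup>*\<close> for the unit quaternion \<open>A\<close> with real part \<open>c\<close> and pure part \<open>a\<close>.\<close>

definition rot :: "real \<Rightarrow> real^3 \<Rightarrow> real^3 \<Rightarrow> real^3"
  where "rot c a p = (2 * c^2 - 1) *\<^sub>R p + (2 * (a \<bullet> p)) *\<^sub>R a + (2 * c) *\<^sub>R (a \<times> p)"

section \<open>Quaternions acting as screw motions\<close>

abbreviation vec_part :: "quat \<Rightarrow> real^3"
  where "vec_part A \<equiv> coords (pure_part A)"

lemmas quat_simps = quat_eq_iff times_quat_def plus_quat_def minus_quat_def uminus_quat_def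
  scaleR_quat_def one_quat_def zero_quat_def of_real_def q_norm_def q_cnj_def pure_part_def

lemma q_cnj_sel [simp]:
  "q_re (q_cnj A) = q_re A" "q_i (q_cnj A) = - q_i A" "q_j (q_cnj A) = - q_j A" "q_ij (q_cnj A) = - q_ij A"
  by (simp_all add: quat_simps)

lemma coords_component [simp]:
  "coords q $ 1 = - q_ij q" "coords q $ 2 = q_j q" "coords q $ 3 = q_i q"
  by (simp_all add: coords_def)

lemma pure_of_eq: "pure_of p = Quat 0 (p $ 3) (p $ 2) (- p $ 1)"
  by (simp add: pure_of_def quat_simps qI_def qJ_def)

lemma vec_part_inner: "vec_part A \<bullet> vec_part A = q_norm A - (q_re A)\<^sup>2"
  by (simp add: inner_vec_def sum_3 quat_simps power2_eq_square)

lemma coords_linear [simp]: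
  "coords (p + q) = coords p + coords q" "coords (p - q) = coords p - coords q"
  "coords (r *\<^sub>R p) = r *\<^sub>R coords p"
  by (simp_all add: vec_eq_iff forall_3 quat_simps)

text \<open>A componentwise polynomial identity modulo the unit norm equation, which turns the usual
  coefficient (squared real part minus squared length of the pure part) into the
  \<open>2 * c^2 - 1\<close> of \<open>rot\<close>.\<close>

lemma coords_conjugation:
  assumes "A \<in> unit_quats" "q \<in> pure_quats"
  shows "coords (A * q * q_cnj A) = rot (q_re A) (vec_part A) (coords q)"
proof -
  have "(q_re A)\<^sup>2 = 1 - (q_i A)\<^sup>2 - (q_j A)\<^sup>2 - (q_ij A)\<^sup>2"
    using assms(1) by (simp add: unit_quats_def quat_simps power2_eq_square)
  then show ?thesis
    using assms(2)
    by (simp add: pure_quats_def vec_eq_iff forall_3 rot_def cross_components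
        inner_vec_def sum_3 quat_simps power2_eq_square) algebra
qed

lemma isom_eq:
  assumes "A \<in> unit_quats"
  shows "isom (v, A) p = coords v + rot (q_re A) (vec_part A) p"
  using coords_conjugation[OF assms pure_of_pure, of p] by (simp add: isom_def coords_pure_of)

lemma coords_pure_part_mult:
  "a \<in> pure_quats \<Longrightarrow> b \<in> pure_quats \<Longrightarrow> coords (pure_part (a * b)) = coords a \<times> coords b"
  by (simp add: pure_quats_def vec_eq_iff forall_3 cross_components quat_simps)

lemma q_norm_mult: "q_norm (p * q) = q_norm p * q_norm q"
  by (simp add: quat_simps algebra_simps)

lemma q_norm_cnj: "q_norm (q_cnj p) = q_norm p"
  by (simp add: quat_simps)

lemma q_cnj_mult: "q_cnj (p * q) = q_cnj q * q_cnj p"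
  by (simp add: quat_simps algebra_simps)

lemma pure_conjugation: "q \<in> pure_quats \<Longrightarrow> A * q * q_cnj A \<in> pure_quats"
  by (simp add: pure_quats_def quat_simps algebra_simps)

text \<open>The multiplication law of the semidirect product. Purity of \<open>w\<close> lets
  \<open>pure_of\<close> undo \<open>coords\<close> between the two maps.\<close>

lemma isom_comp:
  assumes "w \<in> pure_quats"
  shows "isom (v, A) \<circ> isom (w, B) = isom (v + A * w * q_cnj A, A * B)"
proof
  fix p
  have "w + B * pure_of p * q_cnj B \<in> pure_quats"
    using assms pure_conjugation[OF pure_of_pure, of B p] by (simp add: pure_quats_def plus_quat_def)
  then have "(isom (v, A) \<circ> isom (w, B)) p
      = coords (v + A * (w + B * pure_of p * q_cnj B) * q_cnj A)"
    by (simp add: isom_def pure_of_coords del: coords_linear)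
  then show "(isom (v, A) \<circ> isom (w, B)) p = isom (v + A * w * q_cnj A, A * B) p"
    by (simp add: isom_def q_cnj_mult algebra_simps)
qed

text \<open>The unit quaternions cover the rotation group with kernel {1, -1}: the quotient of two
  quaternions inducing the same rotation is central, hence real, and has norm 1.\<close>

lemma isom_eq_iff:
  assumes "A \<in> unit_quats" "B \<in> unit_quats" "v \<in> pure_quats" "w \<in> pure_quats"
  shows "isom (v, A) = isom (w, B) \<longleftrightarrow> v = w \<and> (A = B \<or> A = - B)"
proof
  assume eq: "isom (v, A) = isom (w, B)"
  have z: "pure_of 0 = 0" by (simp add: pure_of_eq quat_simps)
  have "coords v = coords w" using fun_cong[OF eq, of 0] by (simp add: isom_def z)
  then have vw: "v = w" using assms(3,4) by (metis pure_of_coords)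
  have rot: "A * q * q_cnj A = B * q * q_cnj B" if "q \<in> pure_quats" for q
  proof -
    have "coords (A * q * q_cnj A) = coords (B * q * q_cnj B)"
      using fun_cong[OF eq, of "coords q"] that by (simp add: isom_def vw pure_of_coords)
    then show ?thesis using that by (metis pure_of_coords pure_conjugation)
  qed
  have unit: "A * q_cnj A = 1" "q_cnj A * A = 1" "B * q_cnj B = 1" "q_cnj B * B = 1"
    using assms(1,2) by (simp_all add: unit_quats_def quat_simps)
  \<comment> \<open>\<open>q_cnj B\<close> is the inverse of the unit quaternion \<open>B\<close>,
    so \<open>C\<close> measures the difference between \<open>A\<close> and
    \<open>B\<close>.\<close>
  define C where "C = q_cnj B * A"
  have comm: "C * q = q * C" if "q \<in> pure_quats" for q
  proof -
    have "C * q = q_cnj B * (A * q * q_cnj A) * A" by (simp add: C_def mult.assoc unit)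
    also have "\<dots> = (q_cnj B * B) * q * C" by (simp only: rot[OF that]) (simp only: C_def mult.assoc)
    finally show ?thesis by (simp add: unit)
  qed
  have "qI \<in> pure_quats" "qJ \<in> pure_quats" by (simp_all add: qI_def qJ_def pure_quats_def)
  \<comment> \<open>Commuting with \<open>qI\<close> kills the components along \<open>qJ\<close>
    and \<open>qI * qJ\<close>; commuting with \<open>qJ\<close> kills the one along
    \<open>qI\<close>.\<close>
  from comm[OF this(1)] comm[OF this(2)] have C: "C = of_real (q_re C)"
    by (simp add: quat_simps qI_def qJ_def)
  have "q_norm C = 1" using assms(1,2) by (simp add: C_def q_norm_mult q_norm_cnj unit_quats_def)
  then have "(q_re C)\<^sup>2 = 1" using C by (simp add: quat_simps power2_eq_square)
  then have "C = 1 \<or> C = -1" using C by (metis of_real_1 of_real_minus power2_eq_1_iff)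
  moreover have "A = B * C" by (simp add: C_def unit flip: mult.assoc)
  ultimately show "v = w \<and> (A = B \<or> A = - B)" using vw by auto
next
  have "q_cnj (- B) = - q_cnj B" by (simp add: quat_simps)
  then show "v = w \<and> (A = B \<or> A = - B) \<Longrightarrow> isom (v, A) = isom (w, B)"
    by (auto simp: isom_def)
qed

section \<open>The braid relation\<close>

text \<open>Multiply the identity \<open>AB + q_cnj (AB) = 2 Re(AB)\<close> by \<open>A\<close> on
  the right.\<close>

lemma quat_triple: "A * B * A = (2 * q_re (A * B)) *\<^sub>R A - q_norm A *\<^sub>R q_cnj B"
  by (simp add: quat_simps algebra_simps)

lemma q_re_mult: "q_re (A * B) = q_re A * q_re B - vec_part A \<bullet> vec_part B"
  by (simp add: quat_simps inner_vec_def sum_3)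

lemma vec_part_cross_eq_0_iff: "vec_part A \<times> vec_part B = 0 \<longleftrightarrow> A * B = B * A"
  by (auto simp: vec_eq_iff forall_3 cross_components quat_simps algebra_simps)

text \<open>Both signs occur because an isometry determines its quaternion only up to sign.\<close>

lemma quat_braid_iff:
  assumes unit: "A \<in> unit_quats" "B \<in> unit_quats" and re: "q_re A = c" "q_re B = c" "c \<noteq> 0"
    and comm: "A * B \<noteq> B * A"
  shows "A * B * A = B * A * B \<or> A * B * A = - (B * A * B)
    \<longleftrightarrow> vec_part A \<bullet> vec_part B = c\<^sup>2 - 1/2"
proof -
  define t where "t = 2 * q_re (A * B)"
  have t': "t = 2 * q_re (B * A)" by (simp add: t_def q_re_mult inner_commute)
  have triple: "A * B * A = t *\<^sub>R A - q_cnj B" "B * A * B = t *\<^sub>R B - q_cnj A"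
    using unit quat_triple[of A B] quat_triple[of B A]
    by (simp_all add: unit_quats_def flip: t_def t')
  \<comment> \<open>As the real parts agree, \<open>A - B\<close> is pure, so conjugation only
    changes its sign.\<close>
  have "A * B * A - B * A * B = (t - 1) *\<^sub>R (A - B)"
    unfolding triple using re by (simp add: quat_simps algebra_simps)
  moreover have "A \<noteq> B" using comm by auto
  ultimately have plus: "A * B * A = B * A * B \<longleftrightarrow> t = 1"
    by (metis eq_iff_diff_eq_0 scaleR_eq_0_iff)
  have "t = 1" if "A * B * A = - (B * A * B)"
  proof (rule ccontr)
    assume "t \<noteq> 1"
    have "q_re (A * B * A + B * A * B) = 2 * c * (t - 1)"
      unfolding triple using re by (simp add: quat_simps algebra_simps)
    then show False using that \<open>t \<noteq> 1\<close> re(3) by (simp add: quat_simps)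
  qed
  then show ?thesis
    using plus re by (auto simp: t_def q_re_mult power2_eq_square)
qed

section \<open>Translation parts and fixed lines\<close>

lemma rot_add: "rot c a (p + q) = rot c a p + rot c a q"
  and rot_scaleR: "rot c a (r *\<^sub>R p) = r *\<^sub>R rot c a p"
  and rot_diff: "rot c a (p - q) = rot c a p - rot c a q"
  by (simp_all add: rot_def vec_eq_iff forall_3 cross_components inner_vec_def sum_3 algebra_simps)

lemma rot_axis: "a \<bullet> a = 1 - c\<^sup>2 \<Longrightarrow> rot c a a = a"
  by (simp add: rot_def flip: scaleR_add_left)

text \<open>Used for uniqueness of the axis. Pairing with \<open>a\<close> gives
  \<open>k = 0\<close>; pairing with \<open>d\<close> then gives equality in Cauchy-Schwarz, so
  \<open>d\<close> is parallel to \<open>a\<close>.\<close>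

lemma rot_eq_translate:
  assumes "a \<bullet> a = 1 - c\<^sup>2" "a \<noteq> 0" and d: "rot c a d = d + k *\<^sub>R a"
  shows "d = ((a \<bullet> d) / (a \<bullet> a)) *\<^sub>R a"
proof -
  have "a \<bullet> rot c a d = a \<bullet> d"
    by (simp add: rot_def inner_add_right dot_cross_self assms(1)) (simp add: algebra_simps)
  then have "k = 0" using assms(2) by (simp add: d inner_add_right)
  moreover have "d \<bullet> rot c a d = (2 * c\<^sup>2 - 1) * (d \<bullet> d) + 2 * (a \<bullet> d)\<^sup>2"
    by (simp add: rot_def inner_add_right dot_cross_self inner_commute power2_eq_square)
  ultimately have "(a \<bullet> d)\<^sup>2 = (a \<bullet> a) * (d \<bullet> d)"
    by (simp add: d assms(1)) (simp add: algebra_simps)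
  then have "a \<times> d = 0"
    using norm_cross[of a d] by (simp flip: power2_norm_eq_inner)
  then have "(a \<bullet> a) *\<^sub>R d = (a \<bullet> d) *\<^sub>R a" using Lagrange[of a a d] by simp
  then show ?thesis using assms(2)
    by (metis inner_eq_zero_iff real_vector_eq_affinity scaleR_scaleR divide_inverse_commute scaleR_one left_inverse)
qed

context
  fixes c :: real and a b :: "real^3"
  assumes inner: "a \<bullet> a = 1 - c\<^sup>2" "b \<bullet> b = 1 - c\<^sup>2" "a \<bullet> b = c\<^sup>2 - 1/2"
begin

text \<open>The span of \<open>a\<close>, \<open>b\<close>, \<open>a \<times> b\<close> is stable
  under both rotations; with the Gram data fixed, the expansion of triple cross products gives their
  action explicitly.\<close>

lemma rot_pair:
  "rot c a b = (2 * c\<^sup>2 - 1) *\<^sub>R (a + b) + (2 * c) *\<^sub>R (a \<times> b)"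
  "rot c b a = (2 * c\<^sup>2 - 1) *\<^sub>R (a + b) - (2 * c) *\<^sub>R (a \<times> b)"
  "rot c a (a \<times> b) = (2 * c\<^sup>2 - 1) *\<^sub>R (a \<times> b) + (c * (2 * c\<^sup>2 - 1)) *\<^sub>R a - (2 * c * (1 - c\<^sup>2)) *\<^sub>R b"
  "rot c b (a \<times> b) = (2 * c\<^sup>2 - 1) *\<^sub>R (a \<times> b) + (2 * c * (1 - c\<^sup>2)) *\<^sub>R a - (c * (2 * c\<^sup>2 - 1)) *\<^sub>R b"
  by (simp_all add: rot_def dot_cross_self Lagrange inner inner_commute[of b a] cross_skew[of b a])
    (simp_all add: vec_eq_iff algebra_simps power2_eq_square)

text \<open>The two bracketed sums are the translation parts of \<open>aba\<close> and
  \<open>bab\<close>.\<close>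

lemma braid_translation:
  fixes s :: real
  defines "v \<equiv> s *\<^sub>R a" and "w \<equiv> s *\<^sub>R b + a \<times> b"
  shows "(v + rot c a w + rot c a (rot c b v)) - (w + rot c b v + rot c b (rot c a w))
    = (4 * c * s - (3 - 4 * c\<^sup>2)) *\<^sub>R (a \<times> b)"
  unfolding v_def w_def
  by (simp add: rot_add rot_diff rot_scaleR rot_axis rot_pair inner)
    (simp add: vec_eq_iff algebra_simps power2_eq_square)

text \<open>The rotation about \<open>b\<close> sends \<open>q\<close> to
  \<open>q - a \<times> b\<close>, and the translation part restores the lost
  \<open>a \<times> b\<close>. So \<open>q\<close> lies on the axis of the second screw
  motion.\<close>

lemma foot_point_b:
  fixes s :: real
  defines "q \<equiv> (1/2) *\<^sub>R (a \<times> b) + (c/2) *\<^sub>R a"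
  shows "(s *\<^sub>R b + a \<times> b) + rot c b q = q + s *\<^sub>R b"
  unfolding q_def
  by (simp add: rot_add rot_diff rot_scaleR rot_axis rot_pair inner)
    (simp add: vec_eq_iff algebra_simps power2_eq_square)

lemma norm_cross_pair: "norm (a \<times> b) = sqrt (3 - 4 * c\<^sup>2) / 2"
proof -
  have "(norm (a \<times> b))\<^sup>2 = (3 - 4 * c\<^sup>2) / 4"
    unfolding norm_cross unfolding power2_norm_eq_inner inner by (simp add: power2_eq_square algebra_simps)
  then have "norm (a \<times> b) = sqrt ((3 - 4 * c\<^sup>2) / 4)"
    by (metis norm_ge_zero real_sqrt_unique)
  then show ?thesis by (simp add: real_sqrt_divide)
qed

end

lemma pure_part_pure [simp]: "pure_part q \<in> pure_quats"
  by (simp add: pure_quats_def quat_simps)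

lemma pure_quats_closed:
  "p \<in> pure_quats \<Longrightarrow> q \<in> pure_quats \<Longrightarrow> p + q \<in> pure_quats"
  "q \<in> pure_quats \<Longrightarrow> r *\<^sub>R q \<in> pure_quats"
  by (simp_all add: pure_quats_def plus_quat_def scaleR_quat_def)

lemma unit_quats_mult: "A \<in> unit_quats \<Longrightarrow> B \<in> unit_quats \<Longrightarrow> A * B \<in> unit_quats"
  by (simp add: unit_quats_def q_norm_mult)

lemma coords_eq_iff: "p \<in> pure_quats \<Longrightarrow> q \<in> pure_quats \<Longrightarrow> coords p = coords q \<longleftrightarrow> p = q"
  by (metis pure_of_coords)

text \<open>Equality of the two isometries splits into the quaternionic braid relation up to sign
  and equality of translation parts. The second is evaluated only under the inner product condition
  supplied by the first.\<close>

lemma isom_braid_iff: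
  fixes s :: real
  assumes unit: "A \<in> unit_quats" "B \<in> unit_quats" and re: "q_re A = c" "q_re B = c" "c \<noteq> 0"
    and comm: "A * B \<noteq> B * A"
  defines "f \<equiv> isom (elt_a s A)" and "g \<equiv> isom (elt_b s A B)"
  shows "f \<circ> g \<circ> f = g \<circ> f \<circ> g
    \<longleftrightarrow> vec_part A \<bullet> vec_part B = c\<^sup>2 - 1/2 \<and> 4 * c * s = 3 - 4 * c\<^sup>2"
proof -
  let ?a = "vec_part A" and ?b = "vec_part B"
  define v where "v = s *\<^sub>R pure_part A"
  define w where "w = s *\<^sub>R pure_part B + pure_part (pure_part A * pure_part B)"
  have pure: "v \<in> pure_quats" "w \<in> pure_quats"
    by (simp_all add: v_def w_def pure_quats_closed)
  have c: "coords v = s *\<^sub>R ?a" "coords w = s *\<^sub>R ?b + ?a \<times> ?b"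
    by (simp_all add: v_def w_def coords_pure_part_mult)
  define p where "p = v + A * w * q_cnj A + A * (B * v * q_cnj B) * q_cnj A"
  define q where "q = w + B * v * q_cnj B + B * (A * w * q_cnj A) * q_cnj B"
  have "f = isom (v, A)" "g = isom (w, B)"
    by (simp_all add: f_def g_def elt_a_def elt_b_def v_def w_def)
  then have "f \<circ> g \<circ> f = isom (p, A * B * A)" "g \<circ> f \<circ> g = isom (q, B * A * B)"
    by (simp_all add: isom_comp pure p_def q_def q_cnj_mult mult.assoc)
  moreover have pq: "p \<in> pure_quats" "q \<in> pure_quats"
    unfolding p_def q_def by (intro pure_quats_closed pure_conjugation pure)+
  ultimately have "f \<circ> g \<circ> f = g \<circ> f \<circ> g
      \<longleftrightarrow> p = q \<and> (A * B * A = B * A * B \<or> A * B * A = - (B * A * B))"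
    by (simp add: isom_eq_iff unit unit_quats_mult)
  moreover have "p = q \<longleftrightarrow> 4 * c * s = 3 - 4 * c\<^sup>2" if "?a \<bullet> ?b = c\<^sup>2 - 1/2"
  proof -
    have inner: "?a \<bullet> ?a = 1 - c\<^sup>2" "?b \<bullet> ?b = 1 - c\<^sup>2"
      using unit re by (simp_all add: vec_part_inner unit_quats_def)
    have "coords p - coords q = (4 * c * s - (3 - 4 * c\<^sup>2)) *\<^sub>R (?a \<times> ?b)"
      using braid_translation[OF inner that, of s]
      by (simp add: p_def q_def coords_conjugation unit pure pure_conjugation c re)
    \<comment> \<open>Non-commutation makes the cross product nonzero, so its coefficient must
      vanish.\<close>
    moreover have "?a \<times> ?b \<noteq> 0" using comm by (simp add: vec_part_cross_eq_0_iff)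
    ultimately have "coords p = coords q \<longleftrightarrow> 4 * c * s = 3 - 4 * c\<^sup>2"
      by (metis eq_iff_diff_eq_0 scaleR_eq_0_iff)
    then show ?thesis by (simp add: coords_eq_iff pq)
  qed
  ultimately show ?thesis using quat_braid_iff[OF unit re comm] by auto
qed

section \<open>Axis, shift and conjugation\<close>

text \<open>\<open>axis_of\<close> is a definite description, so both parts are needed: the line
  through \<open>P\<close> slides along itself, and for any other invariant parallel line through
  \<open>Q\<close> the vector \<open>P - Q\<close> satisfies
  \<open>rot_eq_translate\<close>.\<close>

lemma axis_of_eq:
  assumes A: "A \<in> unit_quats" "vec_part A \<noteq> 0" and P: "isom (v, A) P = P + k *\<^sub>R vec_part A"
  shows "axis_of (v, A) = range (\<lambda>t. P + t *\<^sub>R vec_part A)"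
proof -
  let ?a = "vec_part A" and ?f = "isom (v, A)"
  have aa: "?a \<bullet> ?a = 1 - (q_re A)\<^sup>2" using A(1) by (simp add: vec_part_inner unit_quats_def)
  have diff: "?f p - ?f q = rot (q_re A) ?a (p - q)" for p q
    by (simp add: isom_eq A rot_diff)
  have "?f (P + t *\<^sub>R ?a) = P + (k + t) *\<^sub>R ?a" for t
    using diff[of "P + t *\<^sub>R ?a" P] by (simp add: P rot_scaleR rot_axis[OF aa] algebra_simps)
  then have "?f ` range (\<lambda>t. P + t *\<^sub>R ?a) = (\<lambda>t. P + t *\<^sub>R ?a) ` range ((+) k)"
    by (simp only: image_image)
  then have inv: "?f ` range (\<lambda>t. P + t *\<^sub>R ?a) = range (\<lambda>t. P + t *\<^sub>R ?a)"
    by (simp only: surj_plus)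
  have uniq: "L = range (\<lambda>t. P + t *\<^sub>R ?a)"
    if L: "L = range (\<lambda>t. Q + t *\<^sub>R ?a)" and fL: "?f ` L = L" for L Q
  proof -
    have "Q \<in> L" unfolding L by (rule range_eqI[of _ _ 0]) simp
    then have "?f Q \<in> L" using fL by blast
    then obtain l where "?f Q = Q + l *\<^sub>R ?a" unfolding L by blast
    then have "rot (q_re A) ?a (P - Q) = (P - Q) + (k - l) *\<^sub>R ?a"
      using diff[of P Q] by (simp add: P algebra_simps)
    then obtain r where r: "P - Q = r *\<^sub>R ?a" using rot_eq_translate[OF aa A(2)] by blast
    have "(\<lambda>t. Q + t *\<^sub>R ?a) ` range ((+) r) = range (\<lambda>t. P + t *\<^sub>R ?a)"
      unfolding image_image using r by (intro image_cong) (auto simp: algebra_simps)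
    then show ?thesis by (simp only: L surj_plus)
  qed
  show ?thesis unfolding axis_of_def prod.case
    using inv uniq by (intro the_equality) blast+
qed

text \<open>Any other connecting vector is \<open>q - p\<close> plus a vector orthogonal to it,
  hence no shorter.\<close>

lemma setdist_lines:
  fixes p q a b :: "'a::euclidean_space"
  assumes "(q - p) \<bullet> a = 0" "(q - p) \<bullet> b = 0"
  shows "setdist (range (\<lambda>t. p + t *\<^sub>R a)) (range (\<lambda>t. q + t *\<^sub>R b)) = norm (q - p)"
proof -
  have "setdist (range (\<lambda>t. p + t *\<^sub>R a)) (range (\<lambda>t. q + t *\<^sub>R b)) = dist p q"
  proof (rule setdist_unique)
    show "p \<in> range (\<lambda>t. p + t *\<^sub>R a)" "q \<in> range (\<lambda>t. q + t *\<^sub>R b)"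
      by (auto intro: range_eqI[of _ _ 0])
    have "norm x \<le> norm (x + y)" if "x \<bullet> y = 0" for x y :: 'a
      using that by (simp add: norm_le inner_add_left inner_add_right inner_commute)
    then have "norm (q - p) \<le> norm ((q - p) + (t *\<^sub>R b - u *\<^sub>R a))" for t u
      using assms by (simp add: inner_diff_right)
    then show "dist p q \<le> dist y z"
      if "y \<in> range (\<lambda>t. p + t *\<^sub>R a) \<and> z \<in> range (\<lambda>t. q + t *\<^sub>R b)" for y z
      using that
      by (auto simp: dist_norm norm_minus_commute algebra_simps)
  qed
  then show ?thesis by (simp add: dist_norm norm_minus_commute)
qed

text \<open>Pairing a decomposition with the nonzero pure part recovers \<open>s\<close>, so the
  description in \<open>vector_shift\<close> is uniquely satisfied.\<close>

lemma shift_eq: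
  assumes w: "w \<in> pure_quats" "orthogonal (coords w) (vec_part A)" and "vec_part A \<noteq> 0"
  shows "shift (s *\<^sub>R pure_part A + w, A) = s * norm (vec_part A)"
proof -
  have uniq: "s' = s"
    if "s *\<^sub>R pure_part A + w = s' *\<^sub>R pure_part A + w'" "orthogonal (coords w') (vec_part A)" for s' w'
  proof -
    have "(coords (s *\<^sub>R pure_part A + w)) \<bullet> vec_part A = (coords (s' *\<^sub>R pure_part A + w')) \<bullet> vec_part A"
      by (simp only: that)
    then show ?thesis using that(2) w(2) assms(3) by (simp add: inner_add_left orthogonal_def)
  qed
  then have "vector_shift (s *\<^sub>R pure_part A + w, A) = s"
    unfolding vector_shift_def prod.case using w by (intro the_equality) blast+
  moreover have "q_norm (pure_part A) = (norm (vec_part A))\<^sup>2"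
    by (metis pure_of_coords pure_part_pure q_norm_pure_of)
  ultimately show ?thesis by (simp add: shift_def)
qed

section \<open>Conjugation by rotations\<close>

lemma rotation_rot:
  assumes "rotation_matrix R"
  shows "R *v rot c a p = rot c (R *v a) (R *v p)"
proof -
  have "(R *v a) \<bullet> (R *v p) = a \<bullet> p"
    using assms by (metis dot_lmul_matrix matrix_vector_mul_assoc matrix_vector_mul_lid
        orthogonal_matrix rotation_matrix_def transpose_matrix_vector)
  \<comment> \<open>A rotation preserves cross products as well as inner products, hence every
    ingredient of \<open>rot\<close>.\<close>
  then show ?thesis
    using cross_rotation_matrix[OF assms, of a p]
    by (simp add: rot_def matrix_vector_right_distrib matrix_vector_mult_scaleR)
qed

text \<open>Stated as an intertwining relation, which avoids the inverse of the conjugating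
  rotation.\<close>

lemma isom_conjugate:
  assumes R: "rotation_matrix R" and unit: "A \<in> unit_quats" "A' \<in> unit_quats"
    and "q_re A' = q_re A" "vec_part A' = R *v vec_part A" "coords v' = R *v coords v"
  shows "(*v) R \<otimes>\<^bsub>isom_group\<^esub> isom (v, A) = isom (v', A') \<otimes>\<^bsub>isom_group\<^esub> (*v) R"
  using assms by (auto simp: isom_group_def isom_eq matrix_vector_right_distrib rotation_rot)

interpretation isom_grp: group isom_group by (rule group_isom_group)

text \<open>The first factor is the eigenvalue along \<open>a\<close>, the second the determinant on
  the plane orthogonal to \<open>a\<close>, where \<open>a \<times> p\<close> is a quarter turn
  scaled by the length of \<open>a\<close>.\<close>

lemma det_rodrigues:
  fixes a :: "real^3"
  shows "det (matrix (\<lambda>p. k *\<^sub>R p + (2 * (a \<bullet> p)) *\<^sub>R a + l *\<^sub>R (a \<times> p)))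
    = (k + 2 * (a \<bullet> a)) * (k\<^sup>2 + l\<^sup>2 * (a \<bullet> a))"
  by (simp add: det_3 matrix_def cross_components inner_vec_def sum_3 axis_def
      power2_eq_square algebra_simps)

lemma isom_direct:
  assumes "A \<in> unit_quats"
  shows "isom (v, A) \<in> carrier isom_group"
proof -
  let ?c = "q_re A" and ?a = "vec_part A"
  define R where "R = matrix (rot ?c ?a)"
  have lin: "linear (rot ?c ?a)" by (intro linearI) (simp_all add: rot_add rot_scaleR)
  have aa: "?a \<bullet> ?a = 1 - ?c\<^sup>2" using assms by (simp add: vec_part_inner unit_quats_def)
  have R: "rot ?c ?a p = R *v p" for p using lin by (simp add: R_def)
  have "rot ?c ?a p \<bullet> rot ?c ?a q = p \<bullet> q" for p q
  proof -
    \<comment> \<open>The cross product with a fixed vector is skew-adjoint, so the mixed terms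
      cancel.\<close>
    have "p \<bullet> (?a \<times> q) = - ((?a \<times> p) \<bullet> q)" "(?a \<times> p) \<bullet> ?a = 0" "?a \<bullet> (?a \<times> q) = 0"
      by (metis cross_skew cross_triple inner_commute inner_minus_left) (simp_all add: dot_cross_self)
    then show ?thesis
      by (simp add: rot_def inner_add_left inner_add_right dot_cross aa inner_commute[of p ?a])
        (simp add: power2_eq_square algebra_simps)
  qed
  then have "orthogonal_matrix R"
    using lin orthogonal_transformation_matrix[of "rot ?c ?a"] unfolding R_def orthogonal_transformation_def by blast
  moreover have "det R = 1"
  proof -
    have "rot ?c ?a = (\<lambda>p. (2 * ?c\<^sup>2 - 1) *\<^sub>R p + (2 * (?a \<bullet> p)) *\<^sub>R ?a + (2 * ?c) *\<^sub>R (?a \<times> p))"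
      by (simp add: rot_def fun_eq_iff)
    then show ?thesis
      by (simp add: R_def det_rodrigues aa) (simp add: power2_eq_square algebra_simps)
  qed
  moreover have "isom (v, A) = (\<lambda>p. coords v + R *v p)"
    using assms by (simp add: fun_eq_iff isom_eq R)
  ultimately show ?thesis
    unfolding isom_group_def direct_isometry_def rotation_matrix_def by auto
qed

section \<open>The explicit family\<close>

text \<open>Splitting the root of the quotient leaves only two radicals, later abstracted to
  \<open>n\<close> and \<open>m\<close>.\<close>

lemma quat_A_eq: "quat_A x = Quat x ((2*x^2 - 1) / (2 * sqrt (1 - x^2)))
    (sqrt (3 - 4*x^2) / (2 * sqrt (1 - x^2))) 0"
  by (simp add: quat_A_def quat_simps qI_def qJ_def real_sqrt_divide)

lemma quat_B_eq: "quat_B x = Quat x (sqrt (1 - x^2)) 0 0"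
  by (simp add: quat_B_def quat_simps qI_def)

lemma vector_4 [simp]:
  "(vector [a, b, c, d] :: 'a::zero ^ 4) $ 1 = a" "(vector [a, b, c, d] :: 'a::zero ^ 4) $ 2 = b"
  "(vector [a, b, c, d] :: 'a::zero ^ 4) $ 3 = c" "(vector [a, b, c, d] :: 'a::zero ^ 4) $ 4 = d"
  by (simp_all add: vector_def)

context
  fixes x :: real
  assumes x: "x^2 < 3/4"
begin

lemma sqrt_pos: "sqrt (1 - x^2) > 0" "sqrt (3 - 4*x^2) > 0"
  using x by simp_all

lemma sqrt_squares: "(sqrt (1 - x^2))\<^sup>2 = 1 - x^2" "(sqrt (3 - 4*x^2))\<^sup>2 = 3 - 4*x^2"
  using x by simp_all

lemma quat_A_unit: "quat_A x \<in> unit_quats"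
proof -
  \<comment> \<open>Knowing the roots only through their signs and squares reduces the claim to
    rational arithmetic.\<close>
  obtain n m where nm: "n > 0" "n\<^sup>2 = 1 - x^2" "m\<^sup>2 = 3 - 4*x^2"
    "quat_A x = Quat x ((2*x^2 - 1) / (2 * n)) (m / (2 * n)) 0"
    using sqrt_pos sqrt_squares quat_A_eq by blast
  have "x^2 + ((2*x^2 - 1) / (2 * n))\<^sup>2 + (m / (2 * n))\<^sup>2 = 1"
    using x by (simp add: power_divide power_mult_distrib nm(2,3) divide_simps)
      (auto simp: power2_eq_square algebra_simps)
  then show ?thesis by (simp add: nm(4) unit_quats_def quat_simps power2_eq_square)
qed

lemma quat_B_unit: "quat_B x \<in> unit_quats"
  using sqrt_squares by (simp add: quat_B_eq unit_quats_def quat_simps power2_eq_square)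

lemma vec_part_quat_AB_inner: "vec_part (quat_A x) \<bullet> vec_part (quat_B x) = x^2 - 1/2"
  using sqrt_pos by (simp add: quat_A_eq quat_B_eq inner_vec_def sum_3 quat_simps field_simps)

lemma quat_AB_not_commute: "quat_A x * quat_B x \<noteq> quat_B x * quat_A x"
  using sqrt_pos by (simp add: quat_A_eq quat_B_eq quat_simps)

lemma homogeneous_a:
  assumes "x \<noteq> 0"
  shows "homogeneous (isom (elt_a ((3 - 4*x^2) / (4*x)) (quat_A x)) p) = matrix_a x *v homogeneous p"
proof -
  obtain n m where nm: "n > 0" "n\<^sup>2 = 1 - x^2" "m\<^sup>2 = 3 - 4*x^2"
    "quat_A x = Quat x ((2*x^2 - 1) / (2 * n)) (m / (2 * n)) 0"
    and def: "n = sqrt (1 - x^2)" "m = sqrt (3 - 4*x^2)"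
    using sqrt_pos sqrt_squares quat_A_eq by blast
  have "(4*x^2 - 3) / (x^2 - 1) = (3 - 4*x^2) / (1 - x^2)"
    using x by (simp add: divide_simps) (simp add: algebra_simps)
  then have s: "sqrt ((4*x^2 - 3) / (x^2 - 1)) = m / n" "sqrt ((3 - 4*x^2)^3) = m^3"
    by (simp_all add: real_sqrt_divide real_sqrt_power def)
  have n: "n \<noteq> 0" using nm(1) by simp
  have d: "2 - 2*x^2 = 2*n^2" "2 * (x^2 - 1) = - (2 * n^2)" "2*x^2 - 2 = - (2*n^2)"
    by (simp_all add: nm)
  \<comment> \<open>The entries of \<open>matrix_a\<close> are brought to the shape of Rodrigues'
    formula, for instance \<open>2*x^2 - 1\<close> plus twice a squared component on the
    diagonal.\<close>
  have e: "(x - 2*x^3) / n = - (x * (2*x^2 - 1) / n)"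
    "(- 4*x^4 + 2*x^2 + 1) / (2*n^2) = (2*x^2 - 1) + m^2 / (2*n^2)"
    "(1 - 2*x^2) * m / - (2*n^2) = (2*x^2 - 1) * m / (2*n^2)"
    "m^3 / (8*x * n) = (3 - 4*x^2) * m / (8*x * n)"
    "(1 - 2*x^2) / - (2*n^2) = (2*x^2 - 1) + (2*x^2 - 1)^2 / (2*n^2)"
    "(- 8*x^4 + 10*x^2 - 3) / (8*x * n) = (3 - 4*x^2) * (2*x^2 - 1) / (8*x * n)"
  proof -
    have "- 4*x^4 + 2*x^2 + 1 = (2*x^2 - 1) * (2*n^2) + m^2"
      "- (1 - 2*x^2) = (2*x^2 - 1) * (2*n^2) + (2*x^2 - 1)^2"
      unfolding nm by algebra+
    moreover have "(c * (2*n^2) + b) / (2*n^2) = c + b / (2*n^2)" for b c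
      using n by (simp add: add_divide_distrib)
    ultimately show "(- 4*x^4 + 2*x^2 + 1) / (2*n^2) = (2*x^2 - 1) + m^2 / (2*n^2)"
      "(1 - 2*x^2) / - (2*n^2) = (2*x^2 - 1) + (2*x^2 - 1)^2 / (2*n^2)"
      by (simp_all only: divide_minus_right minus_divide_left)
    have "x - 2*x^3 = - (x * (2*x^2 - 1))" "m^3 = (3 - 4*x^2) * m"
      "- 8*x^4 + 10*x^2 - 3 = (3 - 4*x^2) * (2*x^2 - 1)"
      unfolding nm(3)[symmetric] by (algebra | use nm(3) in algebra)+
    then show "(x - 2*x^3) / n = - (x * (2*x^2 - 1) / n)"
      "m^3 / (8*x * n) = (3 - 4*x^2) * m / (8*x * n)"
      "(- 8*x^4 + 10*x^2 - 3) / (8*x * n) = (3 - 4*x^2) * (2*x^2 - 1) / (8*x * n)"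
      by simp_all
    show "(1 - 2*x^2) * m / - (2*n^2) = (2*x^2 - 1) * m / (2*n^2)"
      by (simp add: left_diff_distrib diff_divide_distrib)
  qed
  have M: "matrix_a x = vector [
    vector [2*x^2 - 1, - (x * (2*x^2 - 1) / n), x * (m / n), 0],
    vector [x * (2*x^2 - 1) / n, (2*x^2 - 1) + m^2 / (2*n^2), (2*x^2 - 1) * m / (2*n^2),
      (3 - 4*x^2) * m / (8*x * n)],
    vector [- x * (m / n), (2*x^2 - 1) * m / (2*n^2), (2*x^2 - 1) + (2*x^2 - 1)^2 / (2*n^2),
      (3 - 4*x^2) * (2*x^2 - 1) / (8*x * n)],
    vector [0, 0, 0, 1]]"
    unfolding matrix_a_def s d def[symmetric] e ..
  obtain k l where kl: "2*x^2 - 1 = k" "3 - 4*x^2 = l" by blast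
  show ?thesis
    unfolding elt_a_def isom_eq[OF quat_A_unit] M
    by (simp add: vec_eq_iff forall_4 homogeneous_def matrix_vector_mult_def sum_4
        rot_def cross_components inner_vec_def sum_3 nm(4) quat_simps kl)
      (simp add: power2_eq_square distrib_left distrib_right add_divide_distrib diff_divide_distrib
        right_diff_distrib mult_ac)
qed

lemma homogeneous_b:
  assumes "x \<noteq> 0"
  shows "homogeneous (isom (elt_b ((3 - 4*x^2) / (4*x)) (quat_A x) (quat_B x)) p) = matrix_b x *v homogeneous p"
proof -
  obtain n m where nm: "n > 0" "n\<^sup>2 = 1 - x^2" "m\<^sup>2 = 3 - 4*x^2"
    "quat_A x = Quat x ((2*x^2 - 1) / (2 * n)) (m / (2 * n)) 0"
    "quat_B x = Quat x n 0 0"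
    and def: "n = sqrt (1 - x^2)" "m = sqrt (3 - 4*x^2)"
    using sqrt_pos sqrt_squares quat_A_eq quat_B_eq by blast
  have "n \<noteq> 0" using nm(1) by simp
  with assms show ?thesis
    unfolding elt_b_def isom_eq[OF quat_B_unit]
    by (simp add: matrix_b_def vec_eq_iff forall_4 homogeneous_def matrix_vector_mult_def sum_4
        rot_def cross_components inner_vec_def sum_3 nm(4,5) quat_simps flip: def)
      \<comment> \<open>Along the axis direction the rotation has the factor
        \<open>2*x^2 - 1 + 2*n^2\<close>, which is 1.\<close>
      (use nm(2) in algebra)
qed

end

text \<open>At \<open>x = 0\<close> the equation \<open>4 * x * s = 3 - 4 * x^2\<close> for the
  shift parameter has no solution, whence the exclusion. Uniqueness ranges over all shift parameters
  and all non-commuting pairs of unit quaternions with real part \<open>x\<close>.\<close>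

theorem theorem9:
  fixes x :: real
  assumes "x \<in> {- (sqrt 3 / 2)<..<sqrt 3 / 2}" and "x \<noteq> 0"
  shows "\<exists>\<rho> s.
    \<rho> \<in> hom trefoil_group isom_group \<and>
    quat_A x \<in> unit_quats \<and> quat_B x \<in> unit_quats \<and>
    \<rho> (trefoil_elt Gen_a) = isom (elt_a s (quat_A x)) \<and>
    \<rho> (trefoil_elt Gen_b) = isom (elt_b s (quat_A x) (quat_B x)) \<and>
    (\<forall>\<rho>' s' A B.
       \<rho>' \<in> hom trefoil_group isom_group \<and>
       A \<in> unit_quats \<and> B \<in> unit_quats \<and> q_re A = x \<and> q_re B = x \<and> A * B \<noteq> B * A \<and>
       \<rho>' (trefoil_elt Gen_a) = isom (elt_a s' A) \<and>
       \<rho>' (trefoil_elt Gen_b) = isom (elt_b s' A B)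
       \<longrightarrow> conjugate_reps trefoil_group isom_group \<rho> \<rho>') \<and>
    (\<forall>p. homogeneous (\<rho> (trefoil_elt Gen_a) p) = matrix_a x *v homogeneous p) \<and>
    (\<forall>p. homogeneous (\<rho> (trefoil_elt Gen_b) p) = matrix_b x *v homogeneous p) \<and>
    setdist (axis_of (elt_a s (quat_A x))) (axis_of (elt_b s (quat_A x) (quat_B x)))
      = sqrt (3 - 4*x^2) / 4 \<and>
    cos (axes_angle (elt_a s (quat_A x)) (elt_b s (quat_A x) (quat_B x)))
      = (2*x^2 - 1) / (2 - 2*x^2) \<and>
    shift (elt_a s (quat_A x)) = (3 / (4*x) - x) * sqrt (1 - x^2) \<and>
    shift (elt_b s (quat_A x) (quat_B x)) = (3 / (4*x) - x) * sqrt (1 - x^2)"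
proof -
  let ?A = "quat_A x" and ?B = "quat_B x"
  let ?a = "vec_part ?A" and ?b = "vec_part ?B"
  let ?R = "{([(Gen_a, True), (Gen_b, True), (Gen_a, True)],
      [(Gen_b, True), (Gen_a, True), (Gen_b, True)])}"
  \<comment> \<open>The unique root of the equation in \<open>isom_braid_iff\<close>.\<close>
  define s where "s = (3 - 4*x^2) / (4*x)"
  have "\<bar>x\<bar> < sqrt 3 / 2" using assms(1) by auto
  then have "x^2 < (sqrt 3 / 2)^2" by (metis abs_ge_zero power2_abs power_strict_mono zero_less_numeral)
  then have x: "x^2 < 3/4" by (simp add: power_divide)
  note unit = quat_A_unit[OF x] quat_B_unit[OF x]
  have re: "q_re ?A = x" "q_re ?B = x" by (simp_all add: quat_A_eq quat_B_eq)
  note ab = vec_part_quat_AB_inner[OF x]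
  have aa: "?a \<bullet> ?a = 1 - x^2" "?b \<bullet> ?b = 1 - x^2"
    using unit re by (simp_all add: vec_part_inner unit_quats_def)
  have norm: "norm ?a = sqrt (1 - x^2)" "norm ?b = sqrt (1 - x^2)"
    by (simp_all add: norm_eq_sqrt_inner aa)
  have nz: "?a \<noteq> 0" "?b \<noteq> 0" using x aa by auto
  have braid: "isom (elt_a s ?A) \<circ> isom (elt_b s ?A ?B) \<circ> isom (elt_a s ?A)
      = isom (elt_b s ?A ?B) \<circ> isom (elt_a s ?A) \<circ> isom (elt_b s ?A ?B)"
    using isom_braid_iff[OF unit re assms(2) quat_AB_not_commute[OF x]] assms(2) ab
    by (simp add: s_def)
  define f where "f g = (case g of Gen_a \<Rightarrow> isom (elt_a s ?A) | Gen_b \<Rightarrow> isom (elt_b s ?A ?B))" for g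
  have f: "range f \<subseteq> carrier isom_group"
    using unit by (auto simp: f_def elt_a_def elt_b_def isom_direct split: trefoil_gen.split)
  have "word_val isom_group f u = word_val isom_group f v" if "(u, v) \<in> ?R" for u v
    using that braid by (simp add: f_def isom_group_def o_assoc)
  from isom_grp.presented_group_hom_exists[OF f this] obtain \<rho> where
    "\<rho> \<in> hom (presented_group ?R) isom_group" "\<And>g. \<rho> (word_class ?R [(g, True)]) = f g"
    by blast
  then have \<rho>: "\<rho> \<in> hom trefoil_group isom_group"
    and gen: "\<rho> (trefoil_elt Gen_a) = isom (elt_a s ?A)"
      "\<rho> (trefoil_elt Gen_b) = isom (elt_b s ?A ?B)"
    by (simp_all add: trefoil_group_def trefoil_elt_def f_def)
  have conjugate: "\<forall>\<rho>' s' A B.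
       \<rho>' \<in> hom trefoil_group isom_group \<and>
       A \<in> unit_quats \<and> B \<in> unit_quats \<and> q_re A = x \<and> q_re B = x \<and> A * B \<noteq> B * A \<and>
       \<rho>' (trefoil_elt Gen_a) = isom (elt_a s' A) \<and>
       \<rho>' (trefoil_elt Gen_b) = isom (elt_b s' A B)
       \<longrightarrow> conjugate_reps trefoil_group isom_group \<rho> \<rho>'"
  proof (intro allI impI, elim conjE)
    fix \<rho>' s' A B
    assume \<rho>': "\<rho>' \<in> hom trefoil_group isom_group"
      and unit': "A \<in> unit_quats" "B \<in> unit_quats" and re': "q_re A = x" "q_re B = x"
      and comm: "A * B \<noteq> B * A"
      and gen': "\<rho>' (trefoil_elt Gen_a) = isom (elt_a s' A)"
        "\<rho>' (trefoil_elt Gen_b) = isom (elt_b s' A B)"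
    have cl: "trefoil_elt g \<in> carrier trefoil_group" for g
      by (simp add: trefoil_elt_def trefoil_group_def presented_group_def)
    interpret T: group trefoil_group
      unfolding trefoil_group_def by (rule group_presented_group)
    from arg_cong[OF trefoil_relation, of \<rho>']
    have "isom (elt_a s' A) \<circ> isom (elt_b s' A B) \<circ> isom (elt_a s' A)
      = isom (elt_b s' A B) \<circ> isom (elt_a s' A) \<circ> isom (elt_b s' A B)"
      using cl by (simp add: hom_mult[OF \<rho>'] gen' isom_group_def)
    then have ab': "vec_part A \<bullet> vec_part B = x^2 - 1/2" and "4 * x * s' = 3 - 4 * x^2"
      using isom_braid_iff[OF unit' re' assms(2) comm] by blast+
    then have s': "s' = s" using assms(2) by (simp add: s_def field_simps)
    have "?a \<bullet> ?a = vec_part A \<bullet> vec_part A" "?b \<bullet> ?b = vec_part B \<bullet> vec_part B"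
      "?a \<bullet> ?b = vec_part A \<bullet> vec_part B" "?a \<times> ?b \<noteq> 0"
      using unit' re' aa ab ab' quat_AB_not_commute[OF x]
      by (simp_all add: vec_part_inner[of A] vec_part_inner[of B] unit_quats_def vec_part_cross_eq_0_iff)
    \<comment> \<open>A rotation about the origin suffices: the translation parts are built from the
      pure parts by operations that commute with rotations.\<close>
    then obtain R where R: "rotation_matrix R" "R *v ?a = vec_part A" "R *v ?b = vec_part B"
      by (rule rotation_between_pairs)
    have Rc: "(*v) R \<in> carrier isom_group"
      unfolding isom_group_def direct_isometry_def using R(1) by force
    have conj: "\<rho>' (trefoil_elt g) = (*v) R \<otimes>\<^bsub>isom_group\<^esub> \<rho> (trefoil_elt g) \<otimes>\<^bsub>isom_group\<^esub> inv\<^bsub>isom_group\<^esub> (*v) R"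
      for g
    proof -
      have "(*v) R \<otimes>\<^bsub>isom_group\<^esub> \<rho> (trefoil_elt g) = \<rho>' (trefoil_elt g) \<otimes>\<^bsub>isom_group\<^esub> (*v) R"
        using unit unit' re re' R cross_rotation_matrix[OF R(1), of ?a ?b]
        by (cases g) (auto simp: gen gen' elt_a_def elt_b_def s' coords_pure_part_mult
            matrix_vector_right_distrib matrix_vector_mult_scaleR intro!: isom_conjugate)
      moreover have "\<rho> (trefoil_elt g) \<in> carrier isom_group" "\<rho>' (trefoil_elt g) \<in> carrier isom_group"
        using cl \<rho> \<rho>' by (auto simp: hom_def)
      ultimately show ?thesis using Rc by (simp add: isom_grp.inv_solve_right)
    qed
    have "\<rho>' g = (*v) R \<otimes>\<^bsub>isom_group\<^esub> \<rho> g \<otimes>\<^bsub>isom_group\<^esub> inv\<^bsub>isom_group\<^esub> (*v) R"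
      if "g \<in> carrier trefoil_group" for g
      \<comment> \<open>\<open>\<rho>'\<close> and the conjugate of \<open>\<rho>\<close> are
        homomorphisms that agree on the generators.\<close>
      using isom_grp.presented_group_hom_unique[of \<rho>' ?R, OF _ _ _ that[unfolded trefoil_group_def]]
        isom_grp.conjugation_hom[OF \<rho> Rc] \<rho>' conj
      unfolding trefoil_group_def trefoil_elt_def by blast
    then show "conjugate_reps trefoil_group isom_group \<rho> \<rho>'"
      unfolding conjugate_reps_def using Rc by blast
  qed
  \<comment> \<open>The axis passes through the origin; the base point
    \<open>(x/2) *\<^sub>R ?a\<close> is chosen as the foot of the common perpendicular.\<close>
  have axis_a: "axis_of (elt_a s ?A) = range (\<lambda>t. (x/2) *\<^sub>R ?a + t *\<^sub>R ?a)"
    unfolding elt_a_def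
    by (rule axis_of_eq[OF unit(1) nz(1), of _ _ s])
      (simp add: isom_eq unit re rot_scaleR rot_axis aa)
  have axis_b: "axis_of (elt_b s ?A ?B)
      = range (\<lambda>t. ((1/2) *\<^sub>R (?a \<times> ?b) + (x/2) *\<^sub>R ?a) + t *\<^sub>R ?b)"
    unfolding elt_b_def
    by (rule axis_of_eq[OF unit(2) nz(2), of _ _ s])
      (simp add: isom_eq unit re coords_pure_part_mult foot_point_b[OF aa ab])
  let ?d = "((1/2) *\<^sub>R (?a \<times> ?b) + (x/2) *\<^sub>R ?a) - (x/2) *\<^sub>R ?a"
  have "?d \<bullet> ?a = 0" "?d \<bullet> ?b = 0"
    by (simp_all add: dot_cross_self inner_commute[of _ ?a])
  from setdist_lines[OF this]
  have "setdist (axis_of (elt_a s ?A)) (axis_of (elt_b s ?A ?B)) = sqrt (3 - 4*x^2) / 4"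
    unfolding axis_a axis_b by (simp add: norm_cross_pair[OF aa ab])
  moreover have "cos (axes_angle (elt_a s ?A) (elt_b s ?A ?B)) = (2*x^2 - 1) / (2 - 2*x^2)"
  proof -
    have "\<bar>?a \<bullet> ?b / (norm ?a * norm ?b)\<bar> \<le> 1"
      using Cauchy_Schwarz_ineq2[of ?a ?b] nz by (simp add: abs_mult field_simps)
    then have "cos (axes_angle (elt_a s ?A) (elt_b s ?A ?B)) = ?a \<bullet> ?b / (norm ?a * norm ?b)"
      by (simp add: axes_angle_def elt_a_def elt_b_def vec_angle_def cos_arccos_abs)
    also have "norm ?a * norm ?b = 1 - x^2" using x by (simp add: norm)
    finally show ?thesis using x by (simp add: ab divide_simps)
  qed
  moreover have shift: "shift (elt_a s ?A) = s * sqrt (1 - x^2)"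
    "shift (elt_b s ?A ?B) = s * sqrt (1 - x^2)"
  proof -
    \<comment> \<open>For the first generator the component orthogonal to the axis is 0; for the
      second it is the cross product.\<close>
    have "(0::quat) \<in> pure_quats" "coords 0 = 0"
      by (simp_all add: pure_quats_def zero_quat_def vec_eq_iff forall_3)
    then show "shift (elt_a s ?A) = s * sqrt (1 - x^2)"
      using shift_eq[of 0 ?A s] nz norm by (simp add: elt_a_def orthogonal_def)
    show "shift (elt_b s ?A ?B) = s * sqrt (1 - x^2)"
      using shift_eq[of "pure_part (pure_part ?A * pure_part ?B)" ?B s] nz norm
      by (simp add: elt_b_def coords_pure_part_mult orthogonal_cross)
  qed
  have "s * sqrt (1 - x^2) = (3 / (4*x) - x) * sqrt (1 - x^2)"
    using assms(2) by (simp add: s_def field_simps power2_eq_square)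
  then have "shift (elt_a s ?A) = (3 / (4*x) - x) * sqrt (1 - x^2)"
    "shift (elt_b s ?A ?B) = (3 / (4*x) - x) * sqrt (1 - x^2)"
    by (simp_all add: shift)
  moreover have "\<forall>p. homogeneous (\<rho> (trefoil_elt Gen_a) p) = matrix_a x *v homogeneous p"
    "\<forall>p. homogeneous (\<rho> (trefoil_elt Gen_b) p) = matrix_b x *v homogeneous p"
    using homogeneous_a[OF x assms(2)] homogeneous_b[OF x assms(2)] by (simp_all add: gen s_def)
  ultimately show ?thesis
    using \<rho> gen unit conjugate by (intro exI[of _ \<rho>] exI[of _ s] conjI)
qed

end
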